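(* Every equivariant harmonic map $N:\mathbb C\to S^2$ is periodic; that is, there exists $\delta\in\mathbb C\setminus\{0\}$ such that $N(z+\delta)=N(z)$ for all $z\in\mathbb C$.
   Context: $S^2=\mathrm{SU}(2)/\mathrm{U}(1)$ is the round two-sphere, on which $\mathrm{SU}(2)$ acts by rotations. With $z=x+iy$, a smooth map $N:\mathbb C=\mathbb R^2\to S^2$ is equivariant if $N(x,y)=\exp(xA_0)\,\psi(y)$ for some $A_0\in\mathfrak{su}(2)$ and some map $\psi:\mathbb R\to S^2$. Harmonicity is with respect to the conformal structure of $\mathbb C$ and the round metric. *)

theory Defs
  imports "HOL-Analysis.Analysis"
begin

section \<open>SU(2) acting on the two-sphere by rotations\<close>

definition conj_transpose :: "complex^'n^'m \<Rightarrow> complex^'m^'n" where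
  "conj_transpose A = map_matrix cnj (transpose A)"

definition SU2 :: "(complex^2^2) set" where
  "SU2 = {g. g ** conj_transpose g = mat 1 \<and> det g = 1}"

text \<open>The Lie algebra of SU(2): traceless skew-Hermitian matrices.\<close>

definition su2 :: "(complex^2^2) set" where
  "su2 = {A. conj_transpose A = - A \<and> trace A = 0}"

text \<open>
  The exponential series is written out because the library multiplication
  on \<^typ>\<open>complex^2^2\<close>, and hence its power, is not the matrix product.
\<close>

definition matrix_exp :: "complex^'n^'n \<Rightarrow> complex^'n^'n" where
  "matrix_exp A = (\<Sum>k. (1 / fact k) *\<^sub>R (((**) A) ^^ k) (mat 1))"

text \<open>
  The identification of Euclidean 3-space with the traceless Hermitian matrices
  (equivalently, after multiplication by \<^term>\<open>\<i>\<close>, with su(2)) through the Pauli matrices.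
  Conjugation by an element of SU(2) becomes a rotation; restricted to the unit
  sphere it is the action of SU(2) on SU(2)/U(1).
\<close>

definition pauli :: "real^3 \<Rightarrow> complex^2^2" where
  "pauli v = vector [vector [of_real (v$3), of_real (v$1) - \<i> * of_real (v$2)],
                     vector [of_real (v$1) + \<i> * of_real (v$2), - of_real (v$3)]]"

definition SU2_act :: "complex^2^2 \<Rightarrow> real^3 \<Rightarrow> real^3" where
  "SU2_act g v = (THE w. pauli w = g ** pauli v ** conj_transpose g)"

lemma pauli_inject: "pauli v = pauli w \<longleftrightarrow> v = w"
  by (auto simp: pauli_def vec_eq_iff forall_2 forall_3 complex_eq_iff)

lemma pauli_surj:
  assumes "conj_transpose H = H" "trace H = 0"
  shows "\<exists>w. H = pauli w"
proof -
  have H: "cnj (H$j$i) = H$i$j" for i j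
    using arg_cong[OF assms(1), of "\<lambda>M. M$i$j"] by (simp add: conj_transpose_def transpose_def)
  have "Im (H$1$1) = 0" "Im (H$2$2) = 0" "Re (H$1$2) = Re (H$2$1)" "Im (H$1$2) = - Im (H$2$1)"
    using H[of 1 1] H[of 2 2] H[of 1 2] by (simp_all add: complex_eq_iff)
  moreover have "Re (H$2$2) = - Re (H$1$1)"
    using assms(2) by (simp add: trace_def sum_2 complex_eq_iff)
  ultimately have "H = pauli (vector [Re (H$2$1), Im (H$2$1), Re (H$1$1)])"
    by (simp add: pauli_def vec_eq_iff forall_2 complex_eq_iff)
  then show ?thesis ..
qed

lemma pauli_SU2_act:
  assumes "g \<in> SU2"
  shows "pauli (SU2_act g v) = g ** pauli v ** conj_transpose g"
proof -
  have ct: "conj_transpose (A ** B) = conj_transpose B ** conj_transpose A"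
    for A B :: "complex^2^2"
    by (simp add: conj_transpose_def transpose_def vec_eq_iff matrix_matrix_mult_def mult.commute)
  have ct2: "conj_transpose (conj_transpose A) = A" for A :: "complex^2^2"
    by (simp add: conj_transpose_def transpose_def vec_eq_iff)
  let ?H = "g ** pauli v ** conj_transpose g"
  have "conj_transpose (pauli v) = pauli v"
    by (auto simp: pauli_def conj_transpose_def transpose_def vec_eq_iff forall_2 complex_eq_iff)
  then have 1: "conj_transpose ?H = ?H"
    by (simp add: ct ct2 matrix_mul_assoc)
  have "conj_transpose g ** g = mat 1"
    using assms by (simp add: SU2_def matrix_left_right_inverse)
  then have "trace ?H = trace (pauli v)"
    by (metis matrix_mul_assoc matrix_mul_rid trace_mul_sym)
  then have 2: "trace ?H = 0"
    by (simp add: trace_def sum_2 pauli_def)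
  from pauli_surj[OF 1 2] obtain w where w: "?H = pauli w" ..
  show ?thesis
    unfolding SU2_act_def w by (simp add: pauli_inject)
qed

lemma norm_SU2_act:
  assumes "g \<in> SU2"
  shows "norm (SU2_act g v) = norm v"
proof -
  have det_pauli: "det (pauli u) = - of_real ((norm u)\<^sup>2)" for u
    by (simp add: det_2 pauli_def power2_norm_eq_inner inner_vec_def sum_3 complex_eq_iff
        algebra_simps)
  have "det (conj_transpose g) = cnj (det g)"
    by (simp add: det_2 conj_transpose_def transpose_def mult.commute)
  then have "det (pauli (SU2_act g v)) = det (pauli v)"
    using assms by (simp add: pauli_SU2_act det_mul SU2_def)
  then have "complex_of_real ((norm (SU2_act g v))\<^sup>2) = complex_of_real ((norm v)\<^sup>2)"
    by (simp only: det_pauli neg_equal_iff_equal)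
  then have "(norm (SU2_act g v))\<^sup>2 = (norm v)\<^sup>2"
    by (simp only: of_real_eq_iff)
  then show ?thesis by simp
qed

section \<open>Smooth, equivariant and harmonic maps into the two-sphere\<close>

abbreviation S2 :: "(real^3) set" where
  "S2 \<equiv> sphere 0 1"

text \<open>\<open>Ck k f\<close>: all iterated directional derivatives of \<open>f\<close> up to order \<open>k\<close> exist and are continuous.\<close>

primrec Ck :: "nat \<Rightarrow> ('a::real_normed_vector \<Rightarrow> 'b::real_normed_vector) \<Rightarrow> bool" where
  "Ck 0 f \<longleftrightarrow> continuous_on UNIV f"
| "Ck (Suc k) f \<longleftrightarrow>
     f differentiable_on UNIV \<and> (\<forall>v. Ck k (\<lambda>p. frechet_derivative f (at p) v))"

definition smooth :: "('a::real_normed_vector \<Rightarrow> 'b::real_normed_vector) \<Rightarrow> bool" where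
  "smooth f \<longleftrightarrow> (\<forall>k. Ck k f)"

text \<open>A map into \<^term>\<open>S2\<close> is smooth iff it is smooth as a map into the ambient 3-space.\<close>

definition smooth_map_S2 :: "(complex \<Rightarrow> real^3) \<Rightarrow> bool" where
  "smooth_map_S2 N \<longleftrightarrow> range N \<subseteq> S2 \<and> smooth N"

definition equivariant :: "(complex \<Rightarrow> real^3) \<Rightarrow> bool" where
  "equivariant N \<longleftrightarrow>
     (\<exists>A\<^sub>0 \<in> su2. \<exists>\<psi>::real \<Rightarrow> real^3. range \<psi> \<subseteq> S2 \<and>
        (\<forall>x y. N (Complex x y) = SU2_act (matrix_exp (x *\<^sub>R A\<^sub>0)) (\<psi> y)))"

text \<open>
  The Levi-Civita connection of the round metric is the tangential part of the
  flat derivative of the ambient space. Accordingly \<open>cov_deriv N v V\<close> is the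
  covariant derivative, in the direction \<open>v\<close>, of a vector field \<open>V\<close> along \<open>N\<close>
  for the pulled-back connection.
\<close>

definition cov_deriv ::
  "(complex \<Rightarrow> real^3) \<Rightarrow> complex \<Rightarrow> (complex \<Rightarrow> real^3) \<Rightarrow> complex \<Rightarrow> real^3" where
  "cov_deriv N v V z =
     (let D = frechet_derivative V (at z) v in D - (D \<bullet> N z) *\<^sub>R N z)"

text \<open>
  The trace of \<open>\<nabla>dN\<close> for the flat metric on the domain, whose coordinate fields are parallel.
  In two real dimensions a conformal change of this metric only rescales the tension
  field, so its vanishing depends on the conformal structure alone.
\<close>

definition tension :: "(complex \<Rightarrow> real^3) \<Rightarrow> complex \<Rightarrow> real^3" where
  "tension N z =
     cov_deriv N 1 (\<lambda>w. frechet_derivative N (at w) 1) z +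
     cov_deriv N \<i> (\<lambda>w. frechet_derivative N (at w) \<i>) z"

definition harmonic :: "(complex \<Rightarrow> real^3) \<Rightarrow> bool" where
  "harmonic N \<longleftrightarrow> smooth_map_S2 N \<and> (\<forall>z. tension N z = 0)"

end

theory Submission
  imports Defs
begin

text \<open>
  The orbits of a one-parameter subgroup of SU(2) are already closed. A traceless matrix
  squares to a multiple of the identity by Cayley-Hamilton, and for a skew-Hermitian one
  this multiple is negative unless the matrix vanishes; so a non-zero \<open>A \<in> su(2)\<close> is
  \<open>\<theta> J\<close> with \<open>\<theta> > 0\<close> and \<open>J\<^sup>2 = -1\<close>. Such a \<open>J\<close> behaves like the imaginary
  unit in Euler's formula, \<open>exp(t J) = cos t + sin t J\<close>, so \<open>x \<mapsto> exp(x A)\<close> has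
  period \<open>2\<pi>/\<theta>\<close>, and an equivariant map inherits this period in the real direction
  (lemma \<open>equivariant_imp_periodic\<close>). For \<open>A = 0\<close> every real translation is a period.
\<close>

lemma matrix_mult_scaleR_left: "(c *\<^sub>R A) ** B = c *\<^sub>R (A ** B)"
  for A :: "complex^'n^'m" and B :: "complex^'k^'n"
  by (simp add: matrix_matrix_mult_def vec_eq_iff scaleR_sum_right)

lemma matrix_mult_scaleR_right: "A ** (c *\<^sub>R B) = c *\<^sub>R (A ** B)"
  for A :: "complex^'n^'m" and B :: "complex^'k^'n"
  by (simp add: matrix_matrix_mult_def vec_eq_iff scaleR_sum_right)

text \<open>
  Multiplication by \<open>t J\<close> exchanges the two families of Taylor coefficients: it moves the
  cosine part to the sine part and, with the sign from \<open>J\<^sup>2 = -1\<close>, the sine part to the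
  cosine part.
\<close>

lemma exp_series_term_complex_structure:
  fixes J :: "complex^'n^'n"
  assumes J: "J ** J = - mat 1"
  shows "(1 / fact k) *\<^sub>R (((**) (t *\<^sub>R J)) ^^ k) (mat 1) =
    (cos_coeff k * t ^ k) *\<^sub>R mat 1 + (sin_coeff k * t ^ k) *\<^sub>R J"
proof (induction k)
  case 0
  show ?case by simp
next
  case (Suc k)
  have "(1 / fact (Suc k)) *\<^sub>R (((**) (t *\<^sub>R J)) ^^ Suc k) (mat 1) =
      (1 / real (Suc k)) *\<^sub>R ((t *\<^sub>R J) ** ((1 / fact k) *\<^sub>R (((**) (t *\<^sub>R J)) ^^ k) (mat 1)))"
    by (simp add: matrix_mult_scaleR_right)
  also have "\<dots> = (1 / real (Suc k)) *\<^sub>R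
      ((t * (cos_coeff k * t ^ k)) *\<^sub>R J - (t * (sin_coeff k * t ^ k)) *\<^sub>R mat 1)"
    by (simp add: Suc.IH matrix_add_ldistrib matrix_mult_scaleR_left matrix_mult_scaleR_right J
        scaleR_add_right mult_ac)
  also have "\<dots> = (cos_coeff (Suc k) * t ^ Suc k) *\<^sub>R mat 1 + (sin_coeff (Suc k) * t ^ Suc k) *\<^sub>R J"
    by (simp add: cos_coeff_Suc sin_coeff_Suc scaleR_diff_right mult_ac del: of_nat_Suc)
  finally show ?case .
qed

lemma matrix_exp_complex_structure:
  fixes J :: "complex^'n^'n"
  assumes "J ** J = - mat 1"
  shows "matrix_exp (t *\<^sub>R J) = cos t *\<^sub>R mat 1 + sin t *\<^sub>R J"
proof -
  have "(\<lambda>k. (cos_coeff k * t ^ k) *\<^sub>R mat 1 + (sin_coeff k * t ^ k) *\<^sub>R J)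
      sums (cos t *\<^sub>R mat 1 + sin t *\<^sub>R J)"
    using cos_converges[of t] sin_converges[of t] by (intro sums_add sums_scaleR_left) simp_all
  then show ?thesis
    by (simp only: matrix_exp_def exp_series_term_complex_structure[OF assms] sums_unique[symmetric])
qed

text \<open>
  The factor \<open>\<theta>\<close> is the square root of the determinant, which for a matrix in \<open>su(2)\<close>
  is the sum of the squared moduli of the entries of its first column.
\<close>

lemma su2_eq_scaleR_complex_structure:
  assumes "A \<in> su2" and "A \<noteq> 0"
  obtains \<theta> :: real and J where "\<theta> > 0" "J ** J = - mat 1" "A = \<theta> *\<^sub>R J"
proof -
  have skew: "cnj (A$j$i) = - A$i$j" for i j
    using assms(1) by (simp add: su2_def conj_transpose_def transpose_def vec_eq_iff)
  have tr: "A$2$2 = - A$1$1"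
    using assms(1) by (simp add: su2_def trace_def sum_2 eq_neg_iff_add_eq_0 add.commute)
  have off: "A$1$2 = - cnj (A$2$1)"
    using skew[of 2 1] by simp
  define d where "d = (cmod (A$1$1))\<^sup>2 + (cmod (A$2$1))\<^sup>2"
  have sq1: "A$1$1 * A$1$1 = - of_real ((cmod (A$1$1))\<^sup>2)"
    using complex_norm_square[of "A$1$1"] skew[of 1 1] by simp
  have sq2: "A$1$2 * A$2$1 = - of_real ((cmod (A$2$1))\<^sup>2)"
    using complex_norm_square[of "A$2$1"] off by (simp add: mult.commute)
  have "A ** A = (- d) *\<^sub>R mat 1"
    unfolding vec_eq_iff forall_2
    using sq1 sq2
    by (simp add: matrix_matrix_mult_def sum_2 mat_def tr d_def
        scaleR_conv_of_real[where 'a=complex] mult.commute)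
  moreover have "d > 0"
  proof -
    have "A$1$1 \<noteq> 0 \<or> A$2$1 \<noteq> 0"
      using assms(2) tr off by (auto simp: vec_eq_iff forall_2)
    then show ?thesis
      unfolding d_def by (auto intro: add_pos_nonneg add_nonneg_pos)
  qed
  ultimately show thesis
    by (intro that[of "sqrt d" "(1 / sqrt d) *\<^sub>R A"])
      (simp_all add: matrix_mult_scaleR_left matrix_mult_scaleR_right)
qed

lemma matrix_exp_su2_periodic:
  assumes "A \<in> su2"
  obtains T :: real where "T > 0" "\<And>x. matrix_exp ((x + T) *\<^sub>R A) = matrix_exp (x *\<^sub>R A)"
proof (cases "A = 0")
  case True
  then show thesis by (intro that[of 1]) simp_all
next
  case False
  then obtain \<theta> J where \<theta>: "\<theta> > 0" and J: "J ** J = - mat 1" and A: "A = \<theta> *\<^sub>R J"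
    using su2_eq_scaleR_complex_structure[OF assms] by blast
  have "matrix_exp ((x + 2 * pi / \<theta>) *\<^sub>R A) = matrix_exp (x *\<^sub>R A)" for x
  proof -
    have "(x + 2 * pi / \<theta>) * \<theta> = x * \<theta> + 2 * pi"
      using \<theta> by (simp add: field_simps)
    then show ?thesis
      by (simp add: A matrix_exp_complex_structure[OF J])
  qed
  with \<theta> show thesis by (intro that[of "2 * pi / \<theta>"]) simp_all
qed

lemma equivariant_imp_periodic:
  assumes "equivariant N"
  obtains T :: real where "T > 0" "\<And>z. N (z + of_real T) = N z"
proof -
  from assms obtain A \<psi> where A: "A \<in> su2"
    and N: "\<And>x y. N (Complex x y) = SU2_act (matrix_exp (x *\<^sub>R A)) (\<psi> y)"
    unfolding equivariant_def by blast
  from matrix_exp_su2_periodic[OF A] obtain T :: real where "T > 0"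
    and T: "\<And>x. matrix_exp ((x + T) *\<^sub>R A) = matrix_exp (x *\<^sub>R A)"
    by blast
  have "N (z + of_real T) = N z" for z
  proof (cases z)
    case (Complex x y)
    then have "z + of_real T = Complex (x + T) y"
      by (simp add: complex_eq_iff)
    then show ?thesis
      by (simp only: N T Complex)
  qed
  with \<open>T > 0\<close> show thesis by (rule that)
qed

theorem theorem6p4:
  fixes N :: "complex \<Rightarrow> real^3"
  assumes "equivariant N" and "harmonic N"
  shows "\<exists>\<delta>::complex. \<delta> \<noteq> 0 \<and> (\<forall>z. N (z + \<delta>) = N z)"
proof -
  obtain T :: real where "T > 0" "\<And>z. N (z + of_real T) = N z"
    using equivariant_imp_periodic[OF assms(1)] by blast
  then show ?thesis
    by (intro exI[of _ "of_real T"]) simp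
qed

end
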